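(* Let $X$ be a topological space and $f:X\to2^X$ a map. Then $X$ is a compact totally disconnected Hausdorff space and $f$ is upper semicontinuous (i.e. $(X,f)$ is a compact totally disconnected Hausdorff multivalued system) if and only if $(X,f)$ is conjugate to the inverse limit of an inverse system of multivalued systems of finite type (equivalently, of finite directed graphs and graph homomorphisms) satisfying the Mittag-Leffler condition. In particular, if the inverse system is a sequence $(V_0,f_0)\xleftarrow{g_0}(V_1,f_1)\xleftarrow{g_1}(V_2,f_2)\leftarrow\cdots$ in which every bonding map $g_n$ is $+$directional, then the inverse limit is conjugate to a single-valued continuous system.
   Context: $2^X$ is the set of non-empty closed subsets of $X$. $f:X\to2^X$ is upper semicontinuous if for every $x$ and every open $U\supset f(x)$ there is an open neighborhood $V$ of $x$ with $f(y)\subset U$ for all $y\in V$. A multivalued system $(X,f)$ is a compact Hausdorff space with an upper semicontinuous $f:X\to2^X$. Pairs $(X,f)$, $(Y,g)$ are conjugate if there is a homeomorphism $\pi:X\to Y$ with $f(x)=\pi^{-1}(g(\pi(x)))$ for all $x\in X$. A single-valued continuous map $T:Y\to Y$ is regarded as the multivalued map $y\mapsto\{T(y)\}$. A multivalued system of finite type is $(V,f)$ with $V$ a finite discrete set and $f:V\to2^V$; it corresponds to the finite directed graph $(V,E)$ with $(u,v)\in E\iff v\in f(u)$, in which every vertex has an outgoing edge. A graph homomorphism $\varphi:(V_1,E_1)\to(V_2,E_2)$ is a map $V_1\to V_2$ with $(u,v)\in E_1\Rightarrow(\varphi(u),\varphi(v))\in E_2$; it is $+$directional if $(u,v),(u,v')\in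 E_1$ implies $\varphi(v)=\varphi(v')$. An inverse system of multivalued systems $\{g^\eta_\lambda,(X_\lambda,f_\lambda)\}$ over a directed set $(\Lambda,\le)$ consists of multivalued systems $(X_\lambda,f_\lambda)$ and continuous maps $g^\eta_\lambda:X_\eta\to X_\lambda$ for $\lambda\le\eta$ with $g^\eta_\lambda(f_\eta(x))\subset f_\lambda(g^\eta_\lambda(x))$ for all $x\in X_\eta$, $g^\lambda_\lambda=\mathrm{id}$, $g^\nu_\lambda=g^\eta_\lambda\circ g^\nu_\eta$ for $\lambda\le\eta\le\nu$, and satisfying the Mittag-Leffler condition: for every $\lambda$ there is $\gamma\ge\lambda$ with $g^\gamma_\lambda(X_\gamma)=g^\eta_\lambda(X_\eta)$ for all $\eta\ge\gamma$. Its inverse limit is the space $\varprojlim X_\lambda=\{(x_\lambda)\in\prod_\lambda X_\lambda:x_\lambda=g^\eta_\lambda(x_\eta)\ \forall\lambda\le\eta\}$ (topology inherited from the product) with the map $\varprojlim f_\lambda((x_\lambda))=\{(y_\lambda)\in\varprojlim X_\lambda:y_\lambda\in f_\lambda(x_\lambda)\ \forall\lambda\}$. *)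

theory Defs
  imports "HOL-Analysis.Analysis" "Graph_Theory.Pair_Digraph"
begin

section \<open>Multivalued systems\<close>

text \<open>\<open>closed_sets_of X\<close> is $2^X$.\<close>

definition closed_sets_of :: "'a topology \<Rightarrow> 'a set set" where
  "closed_sets_of X = {C. closedin X C \<and> C \<noteq> {}}"

definition upper_semicontinuous :: "'a topology \<Rightarrow> ('a \<Rightarrow> 'a set) \<Rightarrow> bool" where
  "upper_semicontinuous X f \<longleftrightarrow>
     (\<forall>x\<in>topspace X. \<forall>U. openin X U \<and> f x \<subseteq> U \<longrightarrow>
        (\<exists>V. openin X V \<and> x \<in> V \<and> (\<forall>y\<in>V. f y \<subseteq> U)))"

definition totally_disconnected_space :: "'a topology \<Rightarrow> bool" where
  "totally_disconnected_space X \<longleftrightarrow>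
     (\<forall>x\<in>topspace X. connected_component_of_set X x = {x})"

definition multivalued_system :: "'a topology \<Rightarrow> ('a \<Rightarrow> 'a set) \<Rightarrow> bool" where
  "multivalued_system X f \<longleftrightarrow>
     compact_space X \<and> Hausdorff_space X \<and>
     f \<in> topspace X \<rightarrow> closed_sets_of X \<and> upper_semicontinuous X f"

definition finite_type_system :: "'a topology \<Rightarrow> ('a \<Rightarrow> 'a set) \<Rightarrow> bool" where
  "finite_type_system X f \<longleftrightarrow>
     multivalued_system X f \<and> finite (topspace X) \<and> X = discrete_topology (topspace X)"

definition conjugate ::
    "'a topology \<Rightarrow> ('a \<Rightarrow> 'a set) \<Rightarrow> 'b topology \<Rightarrow> ('b \<Rightarrow> 'b set) \<Rightarrow> bool" where
  "conjugate X f Y g \<longleftrightarrow>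
     (\<exists>p. homeomorphic_map X Y p \<and>
          (\<forall>x\<in>topspace X. f x = {z \<in> topspace X. p z \<in> g (p x)}))"

section \<open>Finite directed graphs\<close>

definition graph_of :: "'v set \<Rightarrow> ('v \<Rightarrow> 'v set) \<Rightarrow> 'v pair_pre_digraph" where
  "graph_of V f = \<lparr> pverts = V, parcs = {(u, v). u \<in> V \<and> v \<in> f u} \<rparr>"

definition successors :: "'v pair_pre_digraph \<Rightarrow> 'v \<Rightarrow> 'v set" where
  "successors G u = {v. (u, v) \<in> parcs G}"

definition graph_hom ::
    "'v pair_pre_digraph \<Rightarrow> 'w pair_pre_digraph \<Rightarrow> ('v \<Rightarrow> 'w) \<Rightarrow> bool" where
  "graph_hom G H h \<longleftrightarrow>
     h \<in> pverts G \<rightarrow> pverts H \<and> (\<forall>u v. (u, v) \<in> parcs G \<longrightarrow> (h u, h v) \<in> parcs H)"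

definition plus_directional ::
    "'v pair_pre_digraph \<Rightarrow> 'w pair_pre_digraph \<Rightarrow> ('v \<Rightarrow> 'w) \<Rightarrow> bool" where
  "plus_directional G H h \<longleftrightarrow>
     graph_hom G H h \<and>
     (\<forall>u v v'. (u, v) \<in> parcs G \<and> (u, v') \<in> parcs G \<longrightarrow> h v = h v')"

section \<open>Inverse systems and inverse limits\<close>

text \<open>
  The directed set is a carrier \<open>I\<close> with a preorder \<open>r\<close>, where \<open>(i, j) \<in> r\<close> means
  $i \le j$; the bonding map from stage \<open>j\<close> down to stage \<open>i\<close> is \<open>g i j\<close>.
\<close>

definition directed_set :: "'i set \<Rightarrow> 'i rel \<Rightarrow> bool" where
  "directed_set I r \<longleftrightarrow>
     I \<noteq> {} \<and> preorder_on I r \<and> (\<forall>i\<in>I. \<forall>j\<in>I. \<exists>k\<in>I. (i, k) \<in> r \<and> (j, k) \<in> r)"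

definition mittag_leffler ::
    "'i set \<Rightarrow> 'i rel \<Rightarrow> ('i \<Rightarrow> 'a set) \<Rightarrow> ('i \<Rightarrow> 'i \<Rightarrow> 'a \<Rightarrow> 'a) \<Rightarrow> bool" where
  "mittag_leffler I r V g \<longleftrightarrow>
     (\<forall>i\<in>I. \<exists>k. (i, k) \<in> r \<and> (\<forall>j. (k, j) \<in> r \<longrightarrow> g i k ` V k = g i j ` V j))"

locale inverse_system_of_sets =
  fixes I :: "'i set" and r :: "'i rel"
    and V :: "'i \<Rightarrow> 'a set" and g :: "'i \<Rightarrow> 'i \<Rightarrow> 'a \<Rightarrow> 'a"
  assumes directed: "directed_set I r"
    and bond_maps_to: "(i, j) \<in> r \<Longrightarrow> g i j \<in> V j \<rightarrow> V i"
    and bond_id: "i \<in> I \<Longrightarrow> x \<in> V i \<Longrightarrow> g i i x = x"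
    and bond_comp:
      "(i, j) \<in> r \<Longrightarrow> (j, k) \<in> r \<Longrightarrow> x \<in> V k \<Longrightarrow> g i k x = g i j (g j k x)"
    and mittag_leffler: "mittag_leffler I r V g"

locale multivalued_inverse_system =
  inverse_system_of_sets I r "\<lambda>i. topspace (X i)" g
  for I :: "'i set" and r :: "'i rel"
    and X :: "'i \<Rightarrow> 'a topology" and f :: "'i \<Rightarrow> 'a \<Rightarrow> 'a set"
    and g :: "'i \<Rightarrow> 'i \<Rightarrow> 'a \<Rightarrow> 'a" +
  assumes system: "i \<in> I \<Longrightarrow> multivalued_system (X i) (f i)"
    and bond_continuous: "(i, j) \<in> r \<Longrightarrow> continuous_map (X j) (X i) (g i j)"
    and bond_semiconj:
      "(i, j) \<in> r \<Longrightarrow> x \<in> topspace (X j) \<Longrightarrow> g i j ` f j x \<subseteq> f i (g i j x)"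

locale finite_type_inverse_system = multivalued_inverse_system I r X f g
  for I :: "'i set" and r :: "'i rel"
    and X :: "'i \<Rightarrow> 'a topology" and f :: "'i \<Rightarrow> 'a \<Rightarrow> 'a set"
    and g :: "'i \<Rightarrow> 'i \<Rightarrow> 'a \<Rightarrow> 'a" +
  assumes finite_type: "i \<in> I \<Longrightarrow> finite_type_system (X i) (f i)"

locale graph_inverse_system =
  inverse_system_of_sets I r "\<lambda>i. pverts (G i)" g
  for I :: "'i set" and r :: "'i rel"
    and G :: "'i \<Rightarrow> 'v pair_pre_digraph" and g :: "'i \<Rightarrow> 'i \<Rightarrow> 'v \<Rightarrow> 'v" +
  assumes finite_graph: "i \<in> I \<Longrightarrow> pair_fin_digraph (G i)"
    and outgoing: "i \<in> I \<Longrightarrow> u \<in> pverts (G i) \<Longrightarrow> \<exists>v. (u, v) \<in> parcs (G i)"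
    and bond_hom: "(i, j) \<in> r \<Longrightarrow> graph_hom (G j) (G i) (g i j)"

definition inverse_limit_space ::
    "'i set \<Rightarrow> 'i rel \<Rightarrow> ('i \<Rightarrow> 'a topology) \<Rightarrow> ('i \<Rightarrow> 'i \<Rightarrow> 'a \<Rightarrow> 'a) \<Rightarrow> ('i \<Rightarrow> 'a) topology" where
  "inverse_limit_space I r X g =
     subtopology (product_topology X I) {x. \<forall>(i, j)\<in>r. x i = g i j (x j)}"

definition inverse_limit_map ::
    "'i set \<Rightarrow> 'i rel \<Rightarrow> ('i \<Rightarrow> 'a topology) \<Rightarrow> ('i \<Rightarrow> 'a \<Rightarrow> 'a set) \<Rightarrow> ('i \<Rightarrow> 'i \<Rightarrow> 'a \<Rightarrow> 'a) \<Rightarrow>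
     ('i \<Rightarrow> 'a) \<Rightarrow> ('i \<Rightarrow> 'a) set" where
  "inverse_limit_map I r X f g x =
     {y \<in> topspace (inverse_limit_space I r X g). \<forall>i\<in>I. y i \<in> f i (x i)}"

definition conjugate_to_inverse_limit ::
    "'b topology \<Rightarrow> ('b \<Rightarrow> 'b set) \<Rightarrow> 'i set \<Rightarrow> 'i rel \<Rightarrow>
     ('i \<Rightarrow> 'a topology) \<Rightarrow> ('i \<Rightarrow> 'a \<Rightarrow> 'a set) \<Rightarrow> ('i \<Rightarrow> 'i \<Rightarrow> 'a \<Rightarrow> 'a) \<Rightarrow> bool" where
  "conjugate_to_inverse_limit Y h I r X f g \<longleftrightarrow>
     conjugate Y h (inverse_limit_space I r X g) (inverse_limit_map I r X f g)"

text \<open>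
  The inverse limit of a graph system is that of the corresponding multivalued systems of
  finite type.
\<close>

definition conjugate_to_graph_limit ::
    "'b topology \<Rightarrow> ('b \<Rightarrow> 'b set) \<Rightarrow> 'i set \<Rightarrow> 'i rel \<Rightarrow>
     ('i \<Rightarrow> 'v pair_pre_digraph) \<Rightarrow> ('i \<Rightarrow> 'i \<Rightarrow> 'v \<Rightarrow> 'v) \<Rightarrow> bool" where
  "conjugate_to_graph_limit Y h I r G g \<longleftrightarrow>
     conjugate_to_inverse_limit Y h I r
       (\<lambda>i. discrete_topology (pverts (G i))) (\<lambda>i. successors (G i)) g"

text \<open>
  HOL cannot quantify existentially over types.  The following two predicates therefore fix the
  type of the indices and the type of the stage points through a type argument; a theorem that
  characterises a class of systems on \<open>'a\<close> has to instantiate them with large enough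
  types (below: finite partitions of the space as indices, their blocks as points) for
  existence, and leave them arbitrary for the converse.
\<close>

definition is_finite_type_limit ::
    "'i itself \<Rightarrow> 'v itself \<Rightarrow> 'a topology \<Rightarrow> ('a \<Rightarrow> 'a set) \<Rightarrow> bool" where
  "is_finite_type_limit _ _ X f \<longleftrightarrow>
     (\<exists>(I :: 'i set) r (Y :: 'i \<Rightarrow> 'v topology) F g.
        finite_type_inverse_system I r Y F g \<and> conjugate_to_inverse_limit X f I r Y F g)"

definition is_graph_limit ::
    "'i itself \<Rightarrow> 'v itself \<Rightarrow> 'a topology \<Rightarrow> ('a \<Rightarrow> 'a set) \<Rightarrow> bool" where
  "is_graph_limit _ _ X f \<longleftrightarrow>
     (\<exists>(I :: 'i set) r (G :: 'i \<Rightarrow> 'v pair_pre_digraph) g.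
        graph_inverse_system I r G g \<and> conjugate_to_graph_limit X f I r G g)"

end

theory Submission
  imports Defs
begin

text \<open>
  A compact totally disconnected Hausdorff space is separated by clopen sets, since components and
  quasi-components agree.  Hence it is the limit of its finite clopen partitions \<open>P\<close>.  Joining
  two blocks \<open>A\<close>, \<open>B\<close> of \<open>P\<close> by an edge when some point of \<open>A\<close> has an image in
  \<open>B\<close> makes \<open>P\<close> a graph, and the limit of these graphs has the same graph as \<open>f\<close>, because upper
  semicontinuity separates every pair \<open>(x, z)\<close> with \<open>z \<notin> f x\<close> by a clopen box.

  Conversely, a limit of finite discrete spaces is closed in their product; upper semicontinuity
  of the limit map follows by compactness, because each coordinate condition is locally constant.
  For a \<open>+\<close>directional sequence, the image of \<open>x\<close> has \<open>n\<close>-th coordinate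
  \<open>g n (Suc n) v\<close> for an arbitrary successor \<open>v\<close> of \<open>x (Suc n)\<close>.
\<close>

section \<open>Limits of finite systems\<close>

lemma finite_type_system_discrete:
  assumes "finite V" "\<And>u. u \<in> V \<Longrightarrow> F u \<subseteq> V" "\<And>u. u \<in> V \<Longrightarrow> F u \<noteq> {}"
  shows "finite_type_system (discrete_topology V) F"
proof -
  have "\<exists>W. openin (discrete_topology V) W \<and> x \<in> W \<and> (\<forall>y\<in>W. F y \<subseteq> U)"
    if "x \<in> V" "F x \<subseteq> U" for x U
    using that by (intro exI[of _ "{x}"]) simp
  with assms show ?thesis
    by (simp add: finite_type_system_def multivalued_system_def closed_sets_of_def
        upper_semicontinuous_def compact_space_discrete_topology Pi_iff)
qed

lemma finite_type_inverse_system_of_graphs: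
  assumes "graph_inverse_system I r G g"
  shows "finite_type_inverse_system I r
    (\<lambda>i. discrete_topology (pverts (G i))) (\<lambda>i. successors (G i)) g"
proof -
  interpret graph_inverse_system I r G g by fact
  have r: "i \<in> I" "j \<in> I" if "(i, j) \<in> r" for i j
    using directed that by (auto simp: directed_set_def preorder_on_def)
  have ft: "finite_type_system (discrete_topology (pverts (G i))) (successors (G i))"
    if i: "i \<in> I" for i
  proof (rule finite_type_system_discrete)
    interpret pair_fin_digraph "G i" by (rule finite_graph[OF i])
    show "finite (pverts (G i))" by (rule pair_finite_verts)
    show "successors (G i) u \<subseteq> pverts (G i)" for u
      using in_arcsD2 by (auto simp: successors_def)
  qed (use outgoing[OF i] in \<open>auto simp: successors_def\<close>)
  show ?thesis
  proof (unfold_locales, goal_cases)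
    case 1 show ?case by (rule directed)
  next
    case (2 i j) then show ?case using bond_maps_to by simp
  next
    case (3 i x) then show ?case using bond_id by simp
  next
    case (4 i j k x) then show ?case using bond_comp by simp
  next
    case 5 show ?case using mittag_leffler by simp
  next
    case (6 i) then show ?case using ft by (simp add: finite_type_system_def)
  next
    case (7 i j) then show ?case using bond_maps_to by simp
  next
    case (8 i j x)
    then show ?case using bond_hom[of i j] by (auto simp: successors_def graph_hom_def)
  next
    case (9 i) then show ?case by (rule ft)
  qed
qed

lemma is_finite_type_limit_if_is_graph_limit:
  assumes "is_graph_limit TYPE('i) TYPE('v) X f"
  shows "is_finite_type_limit TYPE('i) TYPE('v) X f"
  using assms finite_type_inverse_system_of_graphs
  unfolding is_graph_limit_def is_finite_type_limit_def conjugate_to_graph_limit_def by blast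

section \<open>Compactness and separation of inverse limits\<close>

context multivalued_inverse_system
begin

lemma bond_in_index: "i \<in> I" "j \<in> I" if "(i, j) \<in> r"
  using directed that by (auto simp: directed_set_def preorder_on_def)

lemma topspace_inverse_limit_space:
  "topspace (inverse_limit_space I r X g) =
     {x \<in> (\<Pi>\<^sub>E i\<in>I. topspace (X i)). \<forall>(i, j)\<in>r. x i = g i j (x j)}"
  by (auto simp: inverse_limit_space_def)

lemma continuous_map_inverse_limit_component:
  "i \<in> I \<Longrightarrow> continuous_map (inverse_limit_space I r X g) (X i) (\<lambda>x. x i)"
  unfolding inverse_limit_space_def
  by (intro continuous_map_from_subtopology continuous_map_product_projection)

lemma Hausdorff_inverse_limit_space: "Hausdorff_space (inverse_limit_space I r X g)"
  unfolding inverse_limit_space_def using system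
  by (auto intro!: Hausdorff_space_subtopology
      simp: Hausdorff_space_product_topology multivalued_system_def)

text \<open>Each equation \<open>x i = g i j (x j)\<close> equalises two continuous maps into the
  Hausdorff space \<open>X i\<close>, so the limit is an intersection of closed sets in a product
  that is compact by Tychonoff.\<close>

lemma compact_inverse_limit_space: "compact_space (inverse_limit_space I r X g)"
proof -
  let ?Q = "product_topology X I"
  let ?E = "\<lambda>(i, j). {x \<in> topspace ?Q. x i = g i j (x j)}"
  have "closedin ?Q (?E ij)" if "ij \<in> r" for ij
  proof -
    obtain i j where ij: "ij = (i, j)" by fastforce
    have "continuous_map ?Q (X i) (\<lambda>x. x i)" "continuous_map ?Q (X j) (\<lambda>x. x j)"
      using that ij bond_in_index by (auto intro: continuous_map_product_projection)
    moreover have "continuous_map ?Q (X i) (\<lambda>x. g i j (x j))"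
      using continuous_map_compose[OF calculation(2) bond_continuous[of i j]] that ij
      by (simp add: o_def)
    moreover have "Hausdorff_space (X i)"
      using system that ij bond_in_index by (auto simp: multivalued_system_def)
    ultimately show ?thesis
      unfolding ij prod.case by (intro closedin_continuous_maps_eq)
  qed
  \<comment> \<open>\<open>closedin_Inter\<close> needs a non-empty family; reflexivity on the
    non-empty \<open>I\<close> supplies a pair.\<close>
  moreover have "r \<noteq> {}"
    using directed by (auto simp: directed_set_def preorder_on_def refl_on_def)
  ultimately have "closedin ?Q (\<Inter>(?E ` r))"
    by (intro closedin_Inter) auto
  also have "\<Inter>(?E ` r) = topspace ?Q \<inter> {x. \<forall>(i, j)\<in>r. x i = g i j (x j)}"
    using \<open>r \<noteq> {}\<close> by auto
  finally have closed: "closedin ?Q \<dots>" .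
  have "compact_space ?Q"
    using system by (simp add: compact_space_product_topology multivalued_system_def)
  then have "compact_space (subtopology ?Q (topspace ?Q \<inter> {x. \<forall>(i, j)\<in>r. x i = g i j (x j)}))"
    using closed by (intro compact_space_subtopology closedin_compact_space)
  then show ?thesis
    unfolding inverse_limit_space_def by (simp only: subtopology_restrict)
qed

end

text \<open>The complement of \<open>U\<close> is compact, so finitely many coordinates already
  exclude all its points from \<open>f x\<close>; fixing these coordinates describes an open
  neighbourhood of \<open>x\<close>.\<close>

lemma upper_semicontinuous_if_discrete_coordinates:
  assumes compact: "compact_space X"
    and q: "\<And>i. i \<in> I \<Longrightarrow> continuous_map X (discrete_topology (V i)) (q i)"
    and f: "\<And>x. x \<in> topspace X \<Longrightarrow> f x = {z \<in> topspace X. \<forall>i\<in>I. q i z \<in> F i (q i x)}"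
  shows "upper_semicontinuous X f"
  unfolding upper_semicontinuous_def
proof (intro ballI allI impI, elim conjE)
  fix x U assume x: "x \<in> topspace X" and U: "openin X U" "f x \<subseteq> U"
  have pre: "openin X {z \<in> topspace X. q i z \<in> S}" if "i \<in> I" for i S
  proof -
    have "{z \<in> topspace X. q i z \<in> S} = {z \<in> topspace X. q i z \<in> S \<inter> V i}"
      using continuous_map_image_subset_topspace[OF q[OF that]] by auto
    then show ?thesis
      using openin_continuous_map_preimage[OF q[OF that], of "S \<inter> V i"] by simp
  qed
  \<comment> \<open>\<open>N i\<close> collects the points that coordinate \<open>i\<close> alone
    keeps out of \<open>f x\<close>.\<close>
  define N where "N i = {z \<in> topspace X. q i z \<in> - F i (q i x)}" for i
  have "compactin X (topspace X - U)"
    using U(1) by (intro closedin_compact_space[OF compact]) blast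
  moreover have "topspace X - U \<subseteq> \<Union>(N ` I)"
    using U(2) f[OF x] by (auto simp: N_def)
  moreover have "openin X B" if "B \<in> N ` I" for B
    using that pre[of _ "- F _ (q _ x)"] unfolding N_def by blast
  ultimately obtain J where J: "finite J" "J \<subseteq> I" "topspace X - U \<subseteq> \<Union>(N ` J)"
    unfolding compactin_def by (metis finite_subset_image)
  \<comment> \<open>On \<open>?W\<close> the coordinates in \<open>J\<close> agree with those of
    \<open>x\<close>, so \<open>f y\<close> avoids the same sets \<open>N i\<close>. The factor
    \<open>topspace X\<close> covers an empty \<open>J\<close>.\<close>
  let ?W = "topspace X \<inter> (\<Inter>i\<in>J. {y \<in> topspace X. q i y \<in> {q i x}})"
  have "openin X ?W"
    using J(1,2) pre[of _ "{q _ x}"] by (intro openin_Int_Inter) blast+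
  moreover have "f y \<subseteq> U" if y: "y \<in> ?W" for y
  proof
    fix z assume "z \<in> f y"
    then have "z \<notin> N i" if "i \<in> J" for i
    proof -
      have "q i y = q i x" "i \<in> I" "q i z \<in> F i (q i y)"
        using that y J(2) f[of y] \<open>z \<in> f y\<close> by blast+
      then show ?thesis by (simp add: N_def)
    qed
    moreover have "z \<in> topspace X"
      using \<open>z \<in> f y\<close> y f[of y] by blast
    ultimately show "z \<in> U" using J(3) by blast
  qed
  ultimately show "\<exists>W. openin X W \<and> x \<in> W \<and> (\<forall>y\<in>W. f y \<subseteq> U)"
    using x by (intro exI[of _ ?W]) auto
qed

text \<open>A connected set has a connected image in a discrete space, hence at most one value in
  each coordinate, and the coordinates separate points.\<close>

lemma totally_disconnected_if_discrete_coordinates: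
  assumes q: "\<And>i. i \<in> I \<Longrightarrow> continuous_map X (discrete_topology (V i)) (q i)"
    and sep: "\<And>x y. x \<in> topspace X \<Longrightarrow> y \<in> topspace X \<Longrightarrow> (\<And>i. i \<in> I \<Longrightarrow> q i x = q i y) \<Longrightarrow> x = y"
  shows "totally_disconnected_space X"
proof -
  have "x = y" if xy: "connected_component_of X x y" for x y
  proof -
    obtain T where T: "connectedin X T" "x \<in> T" "y \<in> T"
      using xy by (auto simp: connected_component_of_def)
    have "q i x = q i y" if "i \<in> I" for i
    proof -
      have "connectedin (discrete_topology (V i)) (q i ` T)"
        by (rule connectedin_continuous_map_image[OF q[OF that] T(1)])
      then show ?thesis
        using T by (auto simp: connectedin_discrete_topology)
    qed
    then show ?thesis
      using sep T connectedin_subset_topspace by blast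
  qed
  then show ?thesis
    unfolding totally_disconnected_space_def
    by (auto simp: connected_component_of_refl)
qed

text \<open>The conjugacy \<open>p\<close> pulls the limit's coordinates back to discrete
  coordinates on \<open>X\<close>, to which the two preceding criteria apply.\<close>

proposition finite_type_limit_properties:
  assumes "is_finite_type_limit TYPE('i) TYPE('v) X f"
  shows "compact_space X \<and> totally_disconnected_space X \<and> Hausdorff_space X \<and>
    upper_semicontinuous X f"
proof -
  obtain I :: "'i set" and r and Y :: "'i \<Rightarrow> 'v topology" and F g
    where sys: "finite_type_inverse_system I r Y F g"
      and "conjugate_to_inverse_limit X f I r Y F g"
    using assms by (auto simp: is_finite_type_limit_def)
  interpret finite_type_inverse_system I r Y F g by fact
  define L where "L = inverse_limit_space I r Y g"
  obtain p where p: "homeomorphic_map X L p"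
    and f: "\<And>x. x \<in> topspace X \<Longrightarrow>
      f x = {z \<in> topspace X. p z \<in> inverse_limit_map I r Y F g (p x)}"
    using \<open>conjugate_to_inverse_limit X f I r Y F g\<close>
    by (auto simp: conjugate_to_inverse_limit_def conjugate_def L_def)
  have hom: "X homeomorphic_space L"
    using p homeomorphic_map_imp_homeomorphic_space by blast
  have compact: "compact_space X"
    using compact_inverse_limit_space homeomorphic_compact_space[OF hom] by (simp add: L_def)
  have Hausdorff: "Hausdorff_space X"
    using Hausdorff_inverse_limit_space homeomorphic_Hausdorff_space[OF hom] by (simp add: L_def)
  have pL: "p z \<in> topspace L" if "z \<in> topspace X" for z
    using that p homeomorphic_imp_surjective_map by blast
  have f': "f x = {z \<in> topspace X. \<forall>i\<in>I. p z i \<in> F i (p x i)}" if "x \<in> topspace X" for x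
    using f[OF that] pL by (auto simp: inverse_limit_map_def L_def)
  have cont: "continuous_map X (discrete_topology (topspace (Y i))) (\<lambda>x. p x i)" if "i \<in> I" for i
  proof -
    have "continuous_map X (Y i) ((\<lambda>x. x i) \<circ> p)"
      using homeomorphic_imp_continuous_map[OF p]
        continuous_map_inverse_limit_component[OF that, folded L_def]
      by (rule continuous_map_compose)
    moreover have "Y i = discrete_topology (topspace (Y i))"
      using finite_type[OF that] by (simp add: finite_type_system_def)
    ultimately show ?thesis by (simp add: o_def)
  qed
  \<comment> \<open>Points of the product are extensional functions, so agreement on
    \<open>I\<close> is equality in the limit.\<close>
  have sep: "x = y"
    if "x \<in> topspace X" "y \<in> topspace X" and eq: "\<And>i. i \<in> I \<Longrightarrow> p x i = p y i" for x y
  proof -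
    have "p x \<in> extensional I" "p y \<in> extensional I"
      using pL that(1,2) by (auto simp: L_def topspace_inverse_limit_space PiE_iff)
    then have "p x = p y" using eq by (rule extensionalityI)
    then show ?thesis
      using homeomorphic_imp_injective_map[OF p] that(1,2) by (simp add: inj_on_def)
  qed
  have "totally_disconnected_space X"
    using cont sep
    by (rule totally_disconnected_if_discrete_coordinates[where q = "\<lambda>i x. p x i" and I = I])
  moreover have "upper_semicontinuous X f"
    using compact cont f'
    by (rule upper_semicontinuous_if_discrete_coordinates
        [where q = "\<lambda>i x. p x i" and I = I and F = F])
  ultimately show ?thesis using compact Hausdorff by blast
qed

section \<open>The system of finite open partitions\<close>

text \<open>In a compact Hausdorff space components are quasi-components, so \<open>{x}\<close> is a
  quasi-component, and a quasi-component is separated from any compact set disjoint from it.\<close>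

lemma clopen_separation:
  assumes X: "compact_space X" "totally_disconnected_space X" "Hausdorff_space X"
    and C: "closedin X C" and x: "x \<in> topspace X" "x \<notin> C"
  obtains U where "openin X U" "closedin X U" "x \<in> U" "U \<inter> C = {}"
proof -
  have "{x} \<in> connected_components_of X"
    using X(2) x(1) by (force simp: connected_components_of_def totally_disconnected_space_def)
  then have "{x} \<in> quasi_components_of X"
    using quasi_eq_connected_components_of[of X] X by blast
  then have "separated_between X {x} C"
    using separated_between_quasi_component_compact closedin_compact_space[OF X(1) C] x(2)
    by (metis disjnt_insert1 disjnt_empty1)
  then obtain U where "closedin X U" "openin X U" "x \<in> U" "C \<subseteq> topspace X - U"
    by (auto simp: separated_between)
  then show thesis
    by (intro that[of U]) auto
qed

section \<open>Finite open partitions, their blocks and their refinements\<close>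

definition open_partitions :: "'a topology \<Rightarrow> 'a set set set" where
  "open_partitions X =
     {P. finite P \<and> partition_on (topspace X) P \<and> (\<forall>A\<in>P. openin X A)}"

text \<open>Finer partitions come later in the order, so bonding maps run from the blocks of
  \<open>Q\<close> to those of the coarser \<open>P\<close>.\<close>

definition refinement :: "'a topology \<Rightarrow> 'a set set rel" where
  "refinement X = {(P, Q). P \<in> open_partitions X \<and> Q \<in> open_partitions X \<and>
     (\<forall>B\<in>Q. \<exists>A\<in>P. B \<subseteq> A)}"

text \<open>
  For a partition \<open>P\<close>, this is the block of \<open>x\<close> if \<open>S = {x}\<close>, and the block containing \<open>B\<close> if \<open>S = B\<close> is a
  block of a refinement of \<open>P\<close>.
\<close>
definition star :: "'a set set \<Rightarrow> 'a set \<Rightarrow> 'a set" where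
  "star P S = \<Union>{A \<in> P. A \<inter> S \<noteq> {}}"

definition partition_graph :: "('a \<Rightarrow> 'a set) \<Rightarrow> 'a set set \<Rightarrow> 'a set pair_pre_digraph" where
  "partition_graph f P =
     \<lparr>pverts = P, parcs = {(A, B). A \<in> P \<and> B \<in> P \<and> (\<exists>x\<in>A. f x \<inter> B \<noteq> {})}\<rparr>"

lemma partition_blocks_eq:
  assumes "partition_on S P" "A \<in> P" "B \<in> P" "A \<inter> B \<noteq> {}"
  shows "A = B"
  using assms disjointD[of P A B] by (auto simp: partition_on_def)

lemma star_eq:
  assumes "partition_on U P" "A \<in> P" "S \<subseteq> A" "S \<noteq> {}"
  shows "star P S = A"
proof -
  have "{B \<in> P. B \<inter> S \<noteq> {}} = {A}"
    using assms partition_blocks_eq[OF assms(1) assms(2)] by blast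
  then show ?thesis by (simp add: star_def)
qed

lemma star_singleton:
  assumes "partition_on U P" "x \<in> U"
  shows "star P {x} \<in> P" "x \<in> star P {x}"
proof -
  obtain A where A: "A \<in> P" "x \<in> A"
    using assms by (auto simp: partition_on_def)
  with star_eq[OF assms(1) A(1), of "{x}"] show "star P {x} \<in> P" "x \<in> star P {x}"
    by auto
qed

lemma open_partitionsD:
  assumes "P \<in> open_partitions X"
  shows "finite P" "partition_on (topspace X) P" "\<And>A. A \<in> P \<Longrightarrow> openin X A"
    "\<And>A. A \<in> P \<Longrightarrow> A \<noteq> {}" "\<And>A. A \<in> P \<Longrightarrow> A \<subseteq> topspace X"
  using assms by (auto simp: open_partitions_def partition_on_def)

lemma star_refinement:
  assumes "(P, Q) \<in> refinement X" "B \<in> Q"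
  shows "star P B \<in> P" "B \<subseteq> star P B"
proof -
  obtain A where "A \<in> P" "B \<subseteq> A"
    using assms by (auto simp: refinement_def)
  moreover have "partition_on (topspace X) P" "B \<noteq> {}"
    using assms by (auto simp: refinement_def dest: open_partitionsD)
  ultimately have "star P B = A"
    by (intro star_eq)
  then show "star P B \<in> P" "B \<subseteq> star P B"
    using \<open>A \<in> P\<close> \<open>B \<subseteq> A\<close> by auto
qed

text \<open>With \<open>S\<close> a singleton this makes the blocks of a point a compatible family;
  with \<open>S\<close> a block of a still finer partition it is the composition law of the bonding
  maps.\<close>

lemma star_star:
  assumes "(P, Q) \<in> refinement X" "S \<noteq> {}" "B \<in> Q" "S \<subseteq> B"
  shows "star P S = star P (star Q S)"
proof -
  have P: "partition_on (topspace X) P" and Q: "partition_on (topspace X) Q"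
    using assms(1) by (auto simp: refinement_def dest: open_partitionsD)
  have "star Q S = B"
    using Q assms by (intro star_eq)
  moreover have "star P S = star P B"
    using star_refinement[OF assms(1,3)] assms P by (intro star_eq) auto
  ultimately show ?thesis by simp
qed

text \<open>The complement of a block is the union of the other blocks, so open blocks are clopen;
  closedness later feeds the finite intersection property.\<close>

lemma closedin_partition_block:
  assumes P: "P \<in> open_partitions X" and A: "A \<in> P"
  shows "closedin X A"
proof -
  have "topspace X - A = \<Union>(P - {A})"
  proof
    show "topspace X - A \<subseteq> \<Union>(P - {A})"
      using partition_onD1[OF open_partitionsD(2)[OF P]] by blast
    show "\<Union>(P - {A}) \<subseteq> topspace X - A"
      using open_partitionsD(5)[OF P] partition_blocks_eq[OF open_partitionsD(2)[OF P] A] by blast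
  qed
  then have "openin X (topspace X - A)"
    using open_partitionsD(3)[OF P] by auto
  then show ?thesis
    using open_partitionsD(5)[OF P A] by (simp add: closedin_def)
qed

lemma common_refinement_open_partitions:
  assumes P: "P \<in> open_partitions X" and Q: "Q \<in> open_partitions X"
  obtains R where "(P, R) \<in> refinement X" "(Q, R) \<in> refinement X"
proof
  \<comment> \<open>Partitions have no empty block, so empty intersections are discarded.\<close>
  let ?R = "(\<lambda>(A, B). A \<inter> B) ` (P \<times> Q) - {{}}"
  have "partition_on (topspace X) ?R"
  proof (rule partition_onI)
    have "\<Union>?R = \<Union>P \<inter> \<Union>Q" by auto
    also have "\<dots> = topspace X"
      using partition_onD1[OF open_partitionsD(2)[OF P], symmetric]
        partition_onD1[OF open_partitionsD(2)[OF Q], symmetric] by simp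
    finally show "\<Union>?R = topspace X" .
    show "disjnt C D" if CD: "C \<in> ?R" "D \<in> ?R" "C \<noteq> D" for C D
    proof (rule ccontr)
      assume "\<not> disjnt C D"
      then obtain z where z: "z \<in> C" "z \<in> D" by (auto simp: disjnt_def)
      obtain A B A' B' where AB: "C = A \<inter> B" "D = A' \<inter> B'" "A \<in> P" "A' \<in> P" "B \<in> Q" "B' \<in> Q"
        using CD(1,2) by auto
      then have "A = A'" "B = B'"
        using z partition_blocks_eq[OF open_partitionsD(2)[OF P], of A A']
          partition_blocks_eq[OF open_partitionsD(2)[OF Q], of B B'] by auto
      with AB CD show False by simp
    qed
  qed auto
  then have "?R \<in> open_partitions X"
    using open_partitionsD[OF P] open_partitionsD[OF Q] by (auto simp: open_partitions_def)
  then show "(P, ?R) \<in> refinement X" "(Q, ?R) \<in> refinement X"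
    using P Q by (auto simp: refinement_def)
qed

text \<open>Deleting the empty set handles \<open>U\<close> empty or equal to the whole space; for
  an empty space the empty partition remains.\<close>

lemma clopen_partition:
  assumes "openin X U" "closedin X U"
  shows "{U, topspace X - U} - {{}} \<in> open_partitions X"
  using assms openin_subset[OF assms(1)]
  by (auto simp: open_partitions_def partition_on_def pairwise_def disjnt_def)

lemma open_partitions_nonempty: "open_partitions X \<noteq> {}"
  using clopen_partition[of X "{}"] by auto

lemma directed_set_refinement: "directed_set (open_partitions X) (refinement X)"
  unfolding directed_set_def
proof (intro conjI ballI)
  show "open_partitions X \<noteq> {}" by (rule open_partitions_nonempty)
  show "preorder_on (open_partitions X) (refinement X)"
    unfolding preorder_on_def
  proof (intro conjI)
    show "trans (refinement X)"
    proof (rule transI)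
      fix P Q R assume PQ: "(P, Q) \<in> refinement X" and QR: "(Q, R) \<in> refinement X"
      have "\<exists>A\<in>P. C \<subseteq> A" if C: "C \<in> R" for C
      proof -
        have "star Q C \<in> Q" "C \<subseteq> star Q C" using star_refinement[OF QR C] .
        then show ?thesis using star_refinement[OF PQ, of "star Q C"] by blast
      qed
      then show "(P, R) \<in> refinement X" using PQ QR by (auto simp: refinement_def)
    qed
  qed (auto simp: refinement_def refl_on_def)
  show "\<exists>R\<in>open_partitions X. (P, R) \<in> refinement X \<and> (Q, R) \<in> refinement X"
    if "P \<in> open_partitions X" "Q \<in> open_partitions X" for P Q
    using common_refinement_open_partitions[OF that]
    by (metis (no_types, lifting) refinement_def mem_Collect_eq case_prodD)
qed

lemma finite_common_refinement:
  assumes "finite J" "J \<subseteq> open_partitions X"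
  shows "\<exists>Q\<in>open_partitions X. \<forall>P\<in>J. (P, Q) \<in> refinement X"
  using assms
proof (induction J rule: finite_induct)
  case empty
  then show ?case using open_partitions_nonempty by auto
next
  case (insert P J)
  then obtain Q where Q: "Q \<in> open_partitions X" "\<forall>P'\<in>J. (P', Q) \<in> refinement X"
    by auto
  obtain R where R: "(P, R) \<in> refinement X" "(Q, R) \<in> refinement X"
    using common_refinement_open_partitions insert.prems Q(1) by (metis insert_subset)
  have "trans (refinement X)"
    using directed_set_refinement by (auto simp: directed_set_def preorder_on_def)
  then have "\<forall>P'\<in>insert P J. (P', R) \<in> refinement X"
    using Q(2) R by (auto elim: transE)
  moreover have "R \<in> open_partitions X"
    using R(1) by (simp add: refinement_def)
  ultimately show ?case by blast
qed

text \<open>Surjectivity of the bonding maps, the source of the Mittag-Leffler condition: a point of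
  a block \<open>A\<close> of \<open>P\<close> lies in some block of \<open>Q\<close>, and
  \<open>star P\<close> sends that block to \<open>A\<close>.\<close>

lemma star_image_refinement:
  assumes "(P, Q) \<in> refinement X"
  shows "star P ` Q = P"
proof (intro equalityI subsetI)
  fix A assume A: "A \<in> P"
  have P: "P \<in> open_partitions X" and Q: "Q \<in> open_partitions X"
    using assms by (auto simp: refinement_def)
  obtain x where x: "x \<in> A" "x \<in> topspace X"
    using open_partitionsD(4,5)[OF P A] by blast
  have B: "star Q {x} \<in> Q" "x \<in> star Q {x}"
    using star_singleton[OF open_partitionsD(2)[OF Q] x(2)] .
  have "star P {x} = star P (star Q {x})"
    using B by (intro star_star[OF assms _ B(1)]) auto
  moreover have "star P {x} = A"
    using x by (intro star_eq[OF open_partitionsD(2)[OF P] A]) auto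
  ultimately show "A \<in> star P ` Q" using B(1) by auto
qed (use star_refinement[OF assms] in auto)

text \<open>The bonding map carries no dependence on \<open>Q\<close>, since \<open>star P\<close>
  sends a block of any refinement to the block of \<open>P\<close> containing it.\<close>

lemma partition_graph_inverse_system:
  assumes f: "f \<in> topspace X \<rightarrow> closed_sets_of X"
  shows "graph_inverse_system (open_partitions X) (refinement X) (partition_graph f) (\<lambda>P Q. star P)"
proof (intro graph_inverse_system.intro inverse_system_of_sets.intro
    graph_inverse_system_axioms.intro, goal_cases)
  case 1 show ?case by (rule directed_set_refinement)
next
  case (2 P Q) then show ?case
    using star_refinement by (auto simp: partition_graph_def)
next
  case (3 P A)
  then show ?case
    by (intro star_eq[OF open_partitionsD(2)])
      (auto simp: partition_graph_def dest: open_partitionsD)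
next
  case (4 P Q R C)
  then have "C \<in> R" "C \<noteq> {}"
    by (auto simp: partition_graph_def refinement_def dest: open_partitionsD)
  then show ?case
    using star_refinement[OF 4(2)] by (intro star_star[OF 4(1), of C "star Q C"]) auto
next
  case 5
  show ?case
    unfolding mittag_leffler_def
  proof
    fix P assume P: "P \<in> open_partitions X"
    then have "(P, P) \<in> refinement X" by (auto simp: refinement_def)
    then show "\<exists>k. (P, k) \<in> refinement X \<and> (\<forall>j. (k, j) \<in> refinement X \<longrightarrow>
        star P ` pverts (partition_graph f k) = star P ` pverts (partition_graph f j))"
      \<comment> \<open>All bonding maps into stage \<open>P\<close> are onto, so the images are
        stable from \<open>P\<close> itself on.\<close>
      by (intro exI[of _ P]) (simp add: star_image_refinement partition_graph_def)
  qed
next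
  case (6 P)
  then have P: "finite P" by (rule open_partitionsD)
  show ?case
  proof
    show "finite (parcs (partition_graph f P))"
      using P by (intro finite_subset[OF _ finite_cartesian_product[OF P P]])
        (auto simp: partition_graph_def)
  qed (use P in \<open>auto simp: partition_graph_def\<close>)
next
  case (7 P A)
  then have A: "A \<in> P" by (simp add: partition_graph_def)
  obtain x where x: "x \<in> A" "x \<in> topspace X"
    using open_partitionsD(4,5)[OF 7(1) A] by blast
  \<comment> \<open>Non-emptiness of \<open>f x\<close> gives the edge: it leads from
    \<open>A\<close> to the block of \<open>y\<close>.\<close>
  then obtain y where y: "y \<in> f x" "y \<in> topspace X"
    using f closedin_subset by (fastforce simp: closed_sets_of_def Pi_iff)
  then show ?case
    using star_singleton[OF open_partitionsD(2)[OF 7(1)] y(2)] x A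
    by (auto simp: partition_graph_def)
next
  case (8 P Q)
  show ?case
    unfolding graph_hom_def
  proof (intro conjI allI impI)
    show "star P \<in> pverts (partition_graph f Q) \<rightarrow> pverts (partition_graph f P)"
      using star_refinement[OF 8] by (auto simp: partition_graph_def)
    fix A B assume "(A, B) \<in> parcs (partition_graph f Q)"
    \<comment> \<open>The point witnessing the edge from \<open>A\<close> to \<open>B\<close> lies
      in the larger block \<open>star P A\<close> too, and its image still meets
      \<open>star P B\<close>.\<close>
    then show "(star P A, star P B) \<in> parcs (partition_graph f P)"
      using star_refinement[OF 8] by (fastforce simp: partition_graph_def)
  qed
qed

text \<open>The conjugacy sends a point to the family of blocks containing it. It is a continuous
  bijection from a compact space to a Hausdorff space, hence a homeomorphism.\<close>

proposition is_graph_limit_partitions: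
  assumes f: "f \<in> topspace X \<rightarrow> closed_sets_of X"
    and X: "compact_space X" "totally_disconnected_space X" "Hausdorff_space X"
    and usc: "upper_semicontinuous X f"
  shows "is_graph_limit TYPE('a set set) TYPE('a set) (X :: 'a topology) f"
proof -
  let ?I = "open_partitions X" and ?r = "refinement X"
  let ?Y = "\<lambda>P. discrete_topology (pverts (partition_graph f P))"
  let ?F = "\<lambda>P. successors (partition_graph f P)"
  let ?g = "\<lambda>P Q. star P"
  interpret finite_type_inverse_system ?I ?r ?Y ?F ?g
    by (intro finite_type_inverse_system_of_graphs partition_graph_inverse_system f)
  define L where "L = inverse_limit_space ?I ?r ?Y ?g"
  have L: "topspace L = {x \<in> (\<Pi>\<^sub>E P\<in>?I. P). \<forall>(P, Q)\<in>?r. x P = star P (x Q)}"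
    unfolding L_def topspace_inverse_limit_space by (simp add: partition_graph_def)
  define p where "p x = (\<lambda>P\<in>?I. star P {x})" for x
  have star_in: "star P {x} \<in> P" "x \<in> star P {x}" if "P \<in> ?I" "x \<in> topspace X" for P x
    using star_singleton[OF open_partitionsD(2)[OF that(1)] that(2)] .
  have pL: "p x \<in> topspace L" if x: "x \<in> topspace X" for x
  proof -
    have "p x \<in> (\<Pi>\<^sub>E P\<in>?I. P)"
      using star_in(1) x by (simp add: p_def)
    moreover have "p x P = star P (p x Q)" if "(P, Q) \<in> ?r" for P Q
    proof -
      have PQ: "P \<in> ?I" "Q \<in> ?I" using that by (auto simp: refinement_def)
      have "star P {x} = star P (star Q {x})"
        using star_in[OF PQ(2) x] by (intro star_star[OF that, of _ "star Q {x}"]) auto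
      then show ?thesis using PQ by (simp add: p_def)
    qed
    ultimately show ?thesis unfolding L by blast
  qed
  have surj: "w \<in> p ` topspace X" if w: "w \<in> topspace L" for w
  proof -
    have wP: "w P \<in> P" if "P \<in> ?I" for P
      using w that unfolding L by (blast dest: PiE_mem)
    have wQ: "w Q \<subseteq> w P" if "(P, Q) \<in> ?r" for P Q
    proof -
      have "w P = star P (w Q)" using w that unfolding L by blast
      moreover have "w Q \<in> Q" using that by (intro wP) (simp add: refinement_def)
      ultimately show ?thesis using star_refinement(2)[OF that] by metis
    qed
    \<comment> \<open>The blocks \<open>w P\<close> shrink under refinement, so finitely many of
      them all contain \<open>w Q\<close> for a common refinement \<open>Q\<close>. Compactness then
      gives a point \<open>z\<close> in every \<open>w P\<close>, and
      \<open>p z = w\<close>.\<close>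
    have fip: "\<Inter>\<F> \<noteq> {}" if \<F>: "finite \<F>" "\<F> \<subseteq> w ` ?I" for \<F>
    proof -
      obtain J where J: "finite J" "J \<subseteq> ?I" "\<F> = w ` J"
        using finite_subset_image[OF \<F>] by blast
      obtain Q where Q: "Q \<in> ?I" "\<forall>P\<in>J. (P, Q) \<in> ?r"
        using finite_common_refinement[OF J(1,2)] by blast
      have "w Q \<noteq> {}" using open_partitionsD(4)[OF Q(1) wP[OF Q(1)]] .
      moreover have "w Q \<subseteq> \<Inter>\<F>" using J(3) Q(2) wQ by blast
      ultimately show ?thesis by blast
    qed
    have closed: "\<forall>C\<in>w ` ?I. closedin X C"
      using wP closedin_partition_block by blast
    have "\<Inter>(w ` ?I) \<noteq> {}"
      by (rule X(1)[unfolded compact_space_fip, THEN spec, THEN mp]) (simp add: closed fip)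
    then obtain z where z: "\<And>P. P \<in> ?I \<Longrightarrow> z \<in> w P" by blast
    obtain P where P: "P \<in> ?I" using open_partitions_nonempty by blast
    have "z \<in> topspace X"
      using open_partitionsD(5)[OF P wP[OF P]] z[OF P] by blast
    moreover have "star P {z} = w P" if "P \<in> ?I" for P
      using z[OF that] by (intro star_eq[OF open_partitionsD(2)[OF that] wP[OF that]]) auto
    then have "p z = w"
      using w by (intro extensionalityI[of _ ?I]) (auto simp: p_def L PiE_iff)
    ultimately show ?thesis by blast
  qed
  have inj: "inj_on p (topspace X)"
  proof (rule inj_onI, rule ccontr)
    fix x y assume xy: "x \<in> topspace X" "y \<in> topspace X" "p x = p y" "x \<noteq> y"
    have "closedin X {y}"
      using X(3) xy(2) by (simp add: closedin_Hausdorff_singleton)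
    then obtain U where U: "openin X U" "closedin X U" "x \<in> U" "U \<inter> {y} = {}"
      using clopen_separation[OF X _ xy(1), of "{y}"] xy(4) by auto
    \<comment> \<open>This partition puts \<open>x\<close> and \<open>y\<close> into different
      blocks, contradicting \<open>p x = p y\<close>.\<close>
    let ?P = "{U, topspace X - U} - {{}}"
    have P: "?P \<in> ?I" using clopen_partition U by blast
    have "star ?P {x} = star ?P {y}"
      using fun_cong[OF xy(3), of ?P] P by (simp add: p_def)
    moreover have "star ?P {x} = U"
      using U by (intro star_eq[OF open_partitionsD(2)[OF P]]) auto
    ultimately show False using star_in(2)[OF P xy(2)] U(4) by simp
  qed
  have "continuous_map X L p"
    unfolding L_def inverse_limit_space_def continuous_map_in_subtopology
  proof
    show "continuous_map X (product_topology ?Y ?I) p"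
      unfolding continuous_map_componentwise
    proof (intro conjI ballI)
      show "p ` topspace X \<subseteq> extensional ?I" by (auto simp: p_def)
      fix P assume P: "P \<in> ?I"
      show "continuous_map X (?Y P) (\<lambda>x. p x P)"
        unfolding continuous_map_def
      proof (intro conjI allI impI)
        show "(\<lambda>x. p x P) \<in> topspace X \<rightarrow> topspace (?Y P)"
          using P star_in by (auto simp: p_def partition_graph_def)
        fix S assume "openin (?Y P) S"
        then have "S \<subseteq> P" by (simp add: partition_graph_def)
        \<comment> \<open>An open set of the discrete stage is a set of blocks, and its preimage is
          their union.\<close>
        have "{x \<in> topspace X. p x P \<in> S} = \<Union>S"
        proof (intro equalityI subsetI)
          fix x assume "x \<in> \<Union>S"
          then obtain A where A: "A \<in> S" "x \<in> A" by blast
          then have "star P {x} = A"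
            using \<open>S \<subseteq> P\<close> by (intro star_eq[OF open_partitionsD(2)[OF P]]) auto
          then show "x \<in> {x \<in> topspace X. p x P \<in> S}"
            using A P \<open>S \<subseteq> P\<close> open_partitionsD(5)[OF P] by (auto simp: p_def)
        next
          fix x assume "x \<in> {x \<in> topspace X. p x P \<in> S}"
          then have "x \<in> topspace X" "star P {x} \<in> S" using P by (simp_all add: p_def)
          then show "x \<in> \<Union>S" using star_in(2)[OF P] by blast
        qed
        moreover have "openin X (\<Union>S)"
          using \<open>S \<subseteq> P\<close> open_partitionsD(3)[OF P] by (intro openin_Union) blast
        ultimately show "openin X {x \<in> topspace X. p x P \<in> S}"
          by simp
      qed
    qed
    show "p \<in> topspace X \<rightarrow> {x. \<forall>(i, j)\<in>?r. x i = star i (x j)}"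
      using pL unfolding L by blast
  qed
  moreover have "p ` topspace X = topspace L"
    using pL surj by blast
  moreover have "Hausdorff_space L"
    unfolding L_def by (rule Hausdorff_inverse_limit_space)
  ultimately have hom: "homeomorphic_map X L p"
    using X(1) inj by (intro continuous_imp_homeomorphic_map)
  have "f x = {z \<in> topspace X. p z \<in> inverse_limit_map ?I ?r ?Y ?F ?g (p x)}"
    if x: "x \<in> topspace X" for x
  proof (intro equalityI subsetI)
    have fx: "closedin X (f x)"
      using f x by (auto simp: closed_sets_of_def Pi_iff)
    {
      fix z assume z: "z \<in> f x"
      then have zX: "z \<in> topspace X" using fx closedin_subset by blast
      \<comment> \<open>The pair \<open>x\<close>, \<open>z\<close> itself witnesses the edge
        between the two blocks.\<close>
      have "p z P \<in> ?F P (p x P)" if P: "P \<in> ?I" for P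
        using star_in[OF P x] star_in[OF P zX] z P
        by (auto simp: partition_graph_def successors_def p_def)
      then have "p z \<in> inverse_limit_map ?I ?r ?Y ?F ?g (p x)"
        using pL[OF zX] unfolding inverse_limit_map_def L_def by blast
      with zX show "z \<in> {z \<in> topspace X. p z \<in> inverse_limit_map ?I ?r ?Y ?F ?g (p x)}"
        by blast
    next
      fix z assume z: "z \<in> {z \<in> topspace X. p z \<in> inverse_limit_map ?I ?r ?Y ?F ?g (p x)}"
      then have zX: "z \<in> topspace X" by blast
      have arc: "\<exists>y\<in>star P {x}. f y \<inter> star P {z} \<noteq> {}" if "P \<in> ?I" for P
      proof -
        have "p z P \<in> ?F P (p x P)"
          using z that unfolding inverse_limit_map_def by blast
        then show ?thesis
          using that by (simp add: successors_def p_def partition_graph_def)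
      qed
      show "z \<in> f x"
      proof (rule ccontr)
        assume "z \<notin> f x"
        \<comment> \<open>The clopen box separating \<open>(x, z)\<close> from the graph of
          \<open>f\<close> is \<open>W\<close> times \<open>C\<close>: upper semicontinuity yields
          \<open>V\<close> around \<open>x\<close> whose points have images missing
          \<open>C\<close>, and \<open>W\<close> is a clopen set around \<open>x\<close> inside
          \<open>V\<close>.\<close>
        then obtain C where C: "openin X C" "closedin X C" "z \<in> C" "C \<inter> f x = {}"
          using clopen_separation[OF X fx zX] by blast
        have "openin X (topspace X - C)" "f x \<subseteq> topspace X - C"
          using C closedin_subset[OF fx] by auto
        then obtain V where V: "openin X V" "x \<in> V" "\<And>y. y \<in> V \<Longrightarrow> f y \<subseteq> topspace X - C"
          using usc x by (force simp: upper_semicontinuous_def)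
        obtain W where W: "openin X W" "closedin X W" "x \<in> W" "W \<inter> (topspace X - V) = {}"
          using clopen_separation[OF X _ x, of "topspace X - V"] V by auto
        have WV: "W \<subseteq> V" using W openin_subset by blast
        let ?P = "{C, topspace X - C} - {{}}" and ?Q = "{W, topspace X - W} - {{}}"
        have P: "?P \<in> ?I" and Q: "?Q \<in> ?I" using clopen_partition C W by blast+
        \<comment> \<open>In \<open>R\<close> the block of \<open>x\<close> lies in \<open>W\<close>
          and that of \<open>z\<close> in \<open>C\<close>, so no edge joins them, against
          \<open>arc\<close>.\<close>
        then obtain R where R: "(?P, R) \<in> ?r" "(?Q, R) \<in> ?r"
          by (rule common_refinement_open_partitions)
        then have RI: "R \<in> ?I" by (simp add: refinement_def)
        have "star ?Q (star R {x}) = star ?Q {x}"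
          using star_in[OF RI x] star_star[OF R(2), of "{x}" "star R {x}"] by simp
        also have "\<dots> = W"
          using W by (intro star_eq[OF open_partitionsD(2)[OF Q]]) auto
        finally have "star R {x} \<subseteq> W"
          using star_refinement[OF R(2) star_in(1)[OF RI x]] by simp
        moreover have "star ?P (star R {z}) = star ?P {z}"
          using star_in[OF RI zX] star_star[OF R(1), of "{z}" "star R {z}"] by simp
        moreover have "star ?P {z} = C"
          using C by (intro star_eq[OF open_partitionsD(2)[OF P]]) auto
        ultimately have "star R {x} \<subseteq> V" "star R {z} \<subseteq> C"
          using star_refinement[OF R(1) star_in(1)[OF RI zX]] WV by auto
        then show False using arc[OF RI] V(3) by blast
      qed
    }
  qed
  then have "conjugate_to_graph_limit X f ?I ?r (partition_graph f) ?g"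
    using hom unfolding conjugate_to_graph_limit_def conjugate_to_inverse_limit_def
      conjugate_def L_def by blast
  then show ?thesis
    using partition_graph_inverse_system[OF f] unfolding is_graph_limit_def by blast
qed

section \<open>Sequences with \<open>+\<close>directional bonding maps\<close>

text \<open>Any \<open>y\<close> in the image of \<open>x\<close> satisfies
  \<open>y n = g n (Suc n) (y (Suc n))\<close>, where \<open>y (Suc n)\<close> is a successor of
  \<open>x (Suc n)\<close>; \<open>+\<close>directionality makes this value independent of the
  successor.\<close>

proposition plus_directional_limit_single_valued:
  fixes Y :: "nat \<Rightarrow> 'v topology"
  assumes sys: "finite_type_inverse_system UNIV {(m, n). m \<le> n} Y F g"
    and dir: "\<And>n. plus_directional (graph_of (topspace (Y (Suc n))) (F (Suc n)))
      (graph_of (topspace (Y n)) (F n)) (g n (Suc n))"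
  defines "L \<equiv> inverse_limit_space UNIV {(m, n). m \<le> n} Y g"
    and "\<Phi> \<equiv> inverse_limit_map UNIV {(m, n). m \<le> n} Y F g"
  obtains T where "continuous_map L L T" "\<And>x. x \<in> topspace L \<Longrightarrow> \<Phi> x = {T x}"
proof -
  interpret finite_type_inverse_system UNIV "{(m, n). m \<le> n}" Y F g by fact
  have L: "x \<in> topspace L \<longleftrightarrow> (\<forall>n. x n \<in> topspace (Y n)) \<and> (\<forall>m n. m \<le> n \<longrightarrow> x m = g m n (x n))" for x
    by (auto simp: L_def topspace_inverse_limit_space PiE_iff)
  have discrete: "Y n = discrete_topology (topspace (Y n))" for n
    using finite_type by (simp add: finite_type_system_def)
  have F: "F n u \<subseteq> topspace (Y n)" "F n u \<noteq> {}" if "u \<in> topspace (Y n)" for n u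
    using system[of n] that closedin_subset
    by (fastforce simp: multivalued_system_def closed_sets_of_def Pi_iff)+
  have unique: "g n (Suc n) v = g n (Suc n) v'"
    if "u \<in> topspace (Y (Suc n))" "v \<in> F (Suc n) u" "v' \<in> F (Suc n) u" for n u v v'
  proof -
    have "(u, v) \<in> parcs (graph_of (topspace (Y (Suc n))) (F (Suc n)))"
      "(u, v') \<in> parcs (graph_of (topspace (Y (Suc n))) (F (Suc n)))"
      using that by (simp_all add: graph_of_def)
    then show ?thesis
      using dir[of n] unfolding plus_directional_def by blast
  qed
  \<comment> \<open>\<open>S n\<close> maps stage \<open>Suc n\<close> to stage \<open>n\<close>.
    Values of \<open>F\<close> are non-empty on the stages, so the choice is a genuine successor
    there.\<close>
  define S where "S n u = g n (Suc n) (SOME v. v \<in> F (Suc n) u)" for n u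
  have S: "S n u = g n (Suc n) v" if "u \<in> topspace (Y (Suc n))" "v \<in> F (Suc n) u" for n u v
    unfolding S_def using that by (intro unique[of u]) (auto intro: someI)
  have S_in: "S n u \<in> F n (g n (Suc n) u)" if u: "u \<in> topspace (Y (Suc n))" for n u
    using bond_semiconj[of n "Suc n" u] S[OF u] F(2)[OF u] u by force
  define T where "T x = (\<lambda>n. S n (x (Suc n)))" for x :: "nat \<Rightarrow> 'v"
  have TF: "T x n \<in> F n (x n)" if "x \<in> topspace L" for x n
  proof -
    have "x (Suc n) \<in> topspace (Y (Suc n))" "x n = g n (Suc n) (x (Suc n))"
      using that L[of x] le_Suc_eq by auto
    then show ?thesis using S_in by (simp add: T_def)
  qed
  have TL: "T x \<in> topspace L" if x: "x \<in> topspace L" for x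
  proof -
    have xY: "x n \<in> topspace (Y n)" for n using x L by blast
    have TY: "T x n \<in> topspace (Y n)" for n using TF[OF x] F(1)[OF xY] by blast
    \<comment> \<open>By \<open>TF\<close>, \<open>T x (Suc n)\<close> is itself a successor of
      \<open>x (Suc n)\<close>, so it may replace the chosen one in \<open>S n\<close>.\<close>
    have Suc: "T x n = g n (Suc n) (T x (Suc n))" for n
      using S[OF xY TF[OF x]] unfolding T_def by blast
    have "T x m = g m n (T x n)" if "m \<le> n" for m n
      using that
    proof (induction n rule: dec_induct)
      case base show ?case using bond_id[of m] TY by simp
    next
      case (step n)
      have "g m (Suc n) (T x (Suc n)) = g m n (g n (Suc n) (T x (Suc n)))"
        using step.hyps TY by (intro bond_comp) auto
      then show ?case using step.IH by (simp only: Suc[of n, symmetric])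
    qed
    then show ?thesis using L TY by blast
  qed
  show thesis
  proof
    have "continuous_map L (Y n) (\<lambda>x. T x n)" for n
    proof -
      \<comment> \<open>Coordinate \<open>n\<close> of \<open>T x\<close> depends only on coordinate
        \<open>Suc n\<close> of \<open>x\<close>, through a map on a discrete space.\<close>
      have "continuous_map (Y (Suc n)) (Y n) (S n)"
      proof -
        have "S n \<in> topspace (Y (Suc n)) \<rightarrow> topspace (Y n)"
          using S_in F(1) bond_maps_to[of n "Suc n"] by fastforce
        then have "continuous_map (discrete_topology (topspace (Y (Suc n)))) (Y n) (S n)"
          by simp
        then show ?thesis using discrete[of "Suc n"] by simp
      qed
      with continuous_map_inverse_limit_component[of "Suc n", folded L_def]
      have "continuous_map L (Y n) (S n \<circ> (\<lambda>x. x (Suc n)))"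
        by (intro continuous_map_compose) auto
      then show ?thesis by (simp add: o_def T_def)
    qed
    then have "continuous_map L (product_topology Y UNIV) T"
      by (simp add: continuous_map_componentwise_UNIV)
    moreover have "T \<in> topspace L \<rightarrow> {x. \<forall>(m, n)\<in>{(m, n). m \<le> n}. x m = g m n (x n)}"
      using TL L by auto
    ultimately show "continuous_map L L T"
      by (subst (2) L_def) (simp add: inverse_limit_space_def continuous_map_in_subtopology)
    fix x assume x: "x \<in> topspace L"
    have "y = T x" if "y \<in> \<Phi> x" for y
    proof
      fix n
      have y: "y \<in> topspace L" "y (Suc n) \<in> F (Suc n) (x (Suc n))"
        using that by (auto simp: \<Phi>_def inverse_limit_map_def L_def)
      then have "y n = g n (Suc n) (y (Suc n))" "x (Suc n) \<in> topspace (Y (Suc n))"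
        using L x le_Suc_eq by blast+
      then show "y n = T x n" using S[of "x (Suc n)" n, OF _ y(2)] unfolding T_def by metis
    qed
    moreover have "T x \<in> \<Phi> x"
      using TL[OF x] TF[OF x] by (simp add: \<Phi>_def inverse_limit_map_def L_def)
    ultimately show "\<Phi> x = {T x}" by blast
  qed
qed

theorem theorem5p15:
  fixes X :: "'a topology" and f :: "'a \<Rightarrow> 'a set"
  assumes "f \<in> topspace X \<rightarrow> closed_sets_of X"
  defines "P \<equiv> compact_space X \<and> totally_disconnected_space X \<and> Hausdorff_space X \<and>
               upper_semicontinuous X f"
  shows "(P \<longleftrightarrow> is_finite_type_limit TYPE('a set set) TYPE('a set) X f) \<and>
         (P \<longleftrightarrow> is_graph_limit TYPE('a set set) TYPE('a set) X f) \<and>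
         (is_finite_type_limit TYPE('i) TYPE('v) X f \<longrightarrow> P) \<and>
         (is_graph_limit TYPE('i) TYPE('v) X f \<longrightarrow> P) \<and>
         (\<forall>(Y :: nat \<Rightarrow> 'v topology) F g.
            finite_type_inverse_system UNIV {(m, n). m \<le> n} Y F g \<and>
            (\<forall>n. plus_directional (graph_of (topspace (Y (Suc n))) (F (Suc n)))
                                  (graph_of (topspace (Y n)) (F n)) (g n (Suc n))) \<longrightarrow>
            (\<exists>(Z :: (nat \<Rightarrow> 'v) topology) T.
               compact_space Z \<and> Hausdorff_space Z \<and> continuous_map Z Z T \<and>
               conjugate (inverse_limit_space UNIV {(m, n). m \<le> n} Y g)
                         (inverse_limit_map UNIV {(m, n). m \<le> n} Y F g)
                         Z (\<lambda>z. {T z})))"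
proof (intro conjI allI impI)
  \<comment> \<open>One cycle gives both equivalences: \<open>P\<close> yields a graph limit, which
    is a finite type limit, which has \<open>P\<close>.\<close>
  show "P \<longleftrightarrow> is_finite_type_limit TYPE('a set set) TYPE('a set) X f"
    "P \<longleftrightarrow> is_graph_limit TYPE('a set set) TYPE('a set) X f"
    using is_graph_limit_partitions[OF assms(1)] finite_type_limit_properties
      is_finite_type_limit_if_is_graph_limit
    unfolding P_def by metis+
  show "is_finite_type_limit TYPE('i) TYPE('v) X f \<Longrightarrow> P"
    "is_graph_limit TYPE('i) TYPE('v) X f \<Longrightarrow> P"
    using finite_type_limit_properties is_finite_type_limit_if_is_graph_limit
    unfolding P_def by metis+
next
  fix Y :: "nat \<Rightarrow> 'v topology" and F g
  assume *: "finite_type_inverse_system UNIV {(m, n). m \<le> n} Y F g \<and>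
    (\<forall>n. plus_directional (graph_of (topspace (Y (Suc n))) (F (Suc n)))
      (graph_of (topspace (Y n)) (F n)) (g n (Suc n)))"
  let ?L = "inverse_limit_space UNIV {(m, n). m \<le> n} Y g"
  let ?F = "inverse_limit_map UNIV {(m, n). m \<le> n} Y F g"
  interpret finite_type_inverse_system UNIV "{(m, n). m \<le> n}" Y F g using * by blast
  obtain T where T: "continuous_map ?L ?L T" "\<And>x. x \<in> topspace ?L \<Longrightarrow> ?F x = {T x}"
    using plus_directional_limit_single_valued * by metis
  have "T x \<in> topspace ?L" if "x \<in> topspace ?L" for x
    using T(1) that by (auto simp: continuous_map_def)
  \<comment> \<open>The single-valued system lives on the limit space itself, with the identity as
    conjugacy.\<close>
  then have "conjugate ?L ?F ?L (\<lambda>z. {T z})"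
    unfolding conjugate_def using T(2) by (intro exI[of _ id]) auto
  then show "\<exists>(Z :: (nat \<Rightarrow> 'v) topology) T.
      compact_space Z \<and> Hausdorff_space Z \<and> continuous_map Z Z T \<and>
      conjugate ?L ?F Z (\<lambda>z. {T z})"
    using compact_inverse_limit_space Hausdorff_inverse_limit_space T(1) by blast
qed

end
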